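(* Let $n$ be a positive integer and $k$ a nonnegative integer. Let $1\leq m_1<m_2<\cdots<m_r\leq n$ be integers, let $q_1,\ldots,q_r$ be positive integers, and let $M$ be the set consisting of $q_1$ different types of $m_1$, $q_2$ different types of $m_2$, ..., $q_r$ different types of $m_r$. Let $cw(n,k,M')$ denote the number of weak compositions of $n$ in which exactly $k$ parts are equal to zero and each nonzero part belongs to $M$. Let $P_{n+k}=(p_{i,j})$ be the $(n+k)\times(n+k)$ matrix defined by $$p_{i,j}=\begin{cases}-1 & \text{if } i=j+1,\\ q_s & \text{if } j-i=m_s-1 \text{ for some } s\in\{1,\ldots,r\},\\ 0 & \text{otherwise.}\end{cases}$$ Then $$cw(n,k,M')=S_n,$$ where $S_n$ is the sum of all principal minors of order $n$ of the matrix $P_{n+k}$.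
   Context: A weak composition of $n$ is an ordered sequence of nonnegative parts whose sum is $n$ (parts equal to $0$ are allowed). Each nonzero part equal to $m_i$ comes in one of $q_i$ types, and weak compositions that differ in the types of their parts are counted as different; there is only one type of zero. *)

theory Defs
  imports
    "Jordan_Normal_Form.Determinant"
    "Jordan_Normal_Form.DL_Submatrix"
begin

text \<open>A part is a pair (size, type). The part sizes are \<open>m 1, \<dots>, m r\<close>, and
  \<open>m s\<close> comes in the \<open>q s\<close> types \<open>1, \<dots>, q s\<close>.\<close>

definition typed_parts :: "nat \<Rightarrow> (nat \<Rightarrow> nat) \<Rightarrow> (nat \<Rightarrow> nat) \<Rightarrow> (nat \<times> nat) set" where
  "typed_parts r m q = {(m s, t) | s t. s \<in> {1..r} \<and> t \<in> {1..q s}}"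

text \<open>The single type of zero part is \<open>(0, 1)\<close>.\<close>

definition with_zero :: "(nat \<times> nat) set \<Rightarrow> (nat \<times> nat) set" where
  "with_zero M = insert (0, 1) M"

definition weak_compositions :: "nat \<Rightarrow> nat \<Rightarrow> (nat \<times> nat) set \<Rightarrow> (nat \<times> nat) list set" where
  "weak_compositions n k M' =
     {ps. set ps \<subseteq> M' \<and> sum_list (map fst ps) = n \<and>
          length (filter (\<lambda>p. fst p = 0) ps) = k}"

definition cw :: "nat \<Rightarrow> nat \<Rightarrow> (nat \<times> nat) set \<Rightarrow> nat" where
  "cw n k M' = card (weak_compositions n k M')"

text \<open>The set counted by \<open>cw\<close> is finite for a finite set of parts, so \<open>card\<close> does not
  collapse to \<open>0\<close>.\<close>

lemma finite_weak_compositions: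
  assumes "finite M'"
  shows "finite (weak_compositions n k M')"
proof (rule finite_subset)
  have "length ps \<le> sum_list (map fst ps) + length (filter (\<lambda>p. fst p = 0) ps)"
    for ps :: "(nat \<times> nat) list"
    by (induction ps) auto
  then show "weak_compositions n k M' \<subseteq> {ps. set ps \<subseteq> M' \<and> length ps \<le> n + k}"
    unfolding weak_compositions_def by blast
  show "finite {ps. set ps \<subseteq> M' \<and> length ps \<le> n + k}"
    by (rule finite_lists_length_le[OF assms])
qed

text \<open>Matrix indices start at \<open>0\<close>, but the entries depend only on \<open>j - i\<close>. The index \<open>s\<close>
  is unique when \<open>m\<close> is injective on \<open>{1..r}\<close>.\<close>

definition P_mat :: "nat \<Rightarrow> nat \<Rightarrow> (nat \<Rightarrow> nat) \<Rightarrow> (nat \<Rightarrow> nat) \<Rightarrow> int mat" where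
  "P_mat N r m q = mat N N (\<lambda>(i, j).
     if i = j + 1 then -1
     else if \<exists>s\<in>{1..r}. int j - int i = int (m s) - 1
     then int (q (THE s. s \<in> {1..r} \<and> int j - int i = int (m s) - 1))
     else 0)"

definition sum_principal_minors :: "nat \<Rightarrow> 'a :: comm_ring_1 mat \<Rightarrow> 'a" where
  "sum_principal_minors n A =
     (\<Sum>I \<in> {I. I \<subseteq> {..<dim_row A} \<and> card I = n}. det (submatrix A I I))"

end

theory Submission
  imports Defs
begin

text \<open>The sum of the principal minors of order \<open>n\<close> of \<open>P\<^bsub>n+k\<^esub>\<close> is the coefficient of \<open>x^k\<close> in
  \<open>F\<^bsub>n+k\<^esub> = det (P\<^bsub>n+k\<^esub> + x 1)\<close>. The matrix \<open>P\<^bsub>N\<^esub> + x 1\<close> is Toeplitz and upper Hessenberg with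
  subdiagonal \<open>-1\<close>, so with \<open>b\<^bsub>l\<^esub>\<close> the number of types of the part \<open>l\<close>, expansion along the first
  column gives \<open>F\<^bsub>N\<^esub> = x F\<^bsub>N-1\<^esub> + (\<Sum>l=1..N. b\<^bsub>l\<^esub> F\<^bsub>N-l\<^esub>)\<close>. Its coefficients satisfy the recursion that
  weak compositions obey on removal of their first part, a zero part accounting for the term
  \<open>x F\<^bsub>N-1\<^esub>\<close>.\<close>

section \<open>Principal minors as coefficients of a shifted determinant\<close>

text \<open>Conjugation by the enumeration \<open>pick I\<close> carries permutations of
  \<open>{0..<card I}\<close> to permutations of \<open>I\<close> and preserves signs. Indexing by
  \<open>I\<close> itself lets all principal minors be compared inside one Leibniz sum over
  \<open>{..<N}\<close>.\<close>

lemma det_submatrix_Leibniz: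
  fixes A :: "'a :: comm_ring_1 mat"
  assumes A: "A \<in> carrier_mat N N" and I: "I \<subseteq> {..<N}"
  shows "det (submatrix A I I) =
    (\<Sum>p | p permutes I. signof p * (\<Prod>i\<in>I. A $$ (i, p i)))"
proof -
  let ?K = "{0..<card I}"
  have fin: "finite I" using I finite_subset by blast
  have "{i. i < N \<and> i \<in> I} = I" using I by auto
  then have sub: "submatrix A I I = mat (card I) (card I) (\<lambda>(i,j). A $$ (pick I i, pick I j))"
    using A by (simp add: submatrix_def)
  have inj: "inj_on (pick I) ?K"
    by (rule linorder_inj_onI') (auto dest: pick_mono_le)
  have "pick I ` ?K \<subseteq> I" using pick_in_set_le by auto
  then have img: "pick I ` ?K = I"
    using inj fin by (intro card_subset_eq) (auto simp: card_image)
  have bij: "bij_betw (pick I) ?K I" using inj img by (simp add: bij_betw_def)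
  \<comment> \<open>This writes \<open>map_permutation\<close> as the explicit conjugation that
    \<open>bij_betw_permutations\<close> speaks of.\<close>
  have mp: "map_permutation ?K (pick I) =
      (\<lambda>\<pi> x. if x \<in> I then pick I (\<pi> (inv_into ?K (pick I) x)) else x)"
    unfolding map_permutation_def restrict_id_def img by (auto simp: fun_eq_iff)
  have bijp: "bij_betw (map_permutation ?K (pick I)) {\<pi>. \<pi> permutes ?K} {\<pi>. \<pi> permutes I}"
    unfolding mp using bij_betw_permutations[OF bij] .
  have "(\<Sum>p | p permutes I. signof p * (\<Prod>i\<in>I. A $$ (i, p i))) =
    (\<Sum>p | p permutes ?K. signof (map_permutation ?K (pick I) p) *
       (\<Prod>i\<in>I. A $$ (i, map_permutation ?K (pick I) p i)))"
    by (rule sum.reindex_bij_betw[OF bijp, symmetric])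
  also have "\<dots> = (\<Sum>p | p permutes ?K. signof p *
       (\<Prod>i\<in>?K. submatrix A I I $$ (i, p i)))"
  proof (intro sum.cong refl)
    fix p assume "p \<in> {p. p permutes ?K}"
    then have p: "p permutes ?K" by simp
    have "(\<Prod>i\<in>I. A $$ (i, map_permutation ?K (pick I) p i)) =
      (\<Prod>i\<in>?K. A $$ (pick I i, map_permutation ?K (pick I) p (pick I i)))"
      by (rule prod.reindex_bij_betw[OF bij, symmetric])
    also have "\<dots> = (\<Prod>i\<in>?K. submatrix A I I $$ (i, p i))"
    proof (intro prod.cong refl)
      fix i assume i: "i \<in> ?K"
      have "p i \<in> ?K" using permutes_in_image[OF p] i by blast
      then show "A $$ (pick I i, map_permutation ?K (pick I) p (pick I i)) = submatrix A I I $$ (i, p i)"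
        unfolding sub using i by (simp add: map_permutation_apply[OF inj])
    qed
    finally show "signof (map_permutation ?K (pick I) p) *
       (\<Prod>i\<in>I. A $$ (i, map_permutation ?K (pick I) p i)) = signof p * (\<Prod>i\<in>?K. submatrix A I I $$ (i, p i))"
      using sign_map_permutation[OF inj p] by simp
  qed
  also have "\<dots> = det (submatrix A I I)"
    by (rule det_def'[symmetric]) (simp add: sub)
  finally show ?thesis by simp
qed

text \<open>Multiply out each Leibniz product, with \<open>I\<close> the set of rows where the entry
  of \<open>A\<close> is chosen. Every other row contributes \<open>x\<close> at a fixed point and 0
  elsewhere, so only permutations of \<open>I\<close> survive.\<close>

lemma det_add_scalar_mat:
  fixes A :: "'a :: comm_ring_1 mat"
  assumes A: "A \<in> carrier_mat N N"
  shows "det (A + x \<cdot>\<^sub>m 1\<^sub>m N) = (\<Sum>I\<in>Pow {..<N}. det (submatrix A I I) * x ^ (N - card I))"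
proof -
  let ?P = "{p. p permutes {0..<N}}"
  let ?t = "\<lambda>I p. signof p *
    ((\<Prod>i\<in>I. A $$ (i, p i)) * (\<Prod>i\<in>{..<N}-I. if p i = i then x else 0))"
  have summand: "(\<Sum>p\<in>?P. ?t I p) = det (submatrix A I I) * x ^ (N - card I)" if I: "I \<in> Pow {..<N}" for I
  proof -
    have fin: "finite I" and I': "I \<subseteq> {..<N}" using I finite_subset by auto
    have "(\<Sum>p\<in>?P. ?t I p) = (\<Sum>p | p permutes I. ?t I p)"
    proof (rule sum.mono_neutral_right)
      show "finite ?P" by (simp add: finite_permutations)
      show "{p. p permutes I} \<subseteq> ?P" using permutes_subset I' by (auto simp: atLeast0LessThan)
      show "\<forall>p\<in>?P - {p. p permutes I}. ?t I p = 0"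
      proof
        fix p assume p: "p \<in> ?P - {p. p permutes I}"
        \<comment> \<open>A permutation of \<open>{0..<N}\<close> fixing every point outside
          \<open>I\<close> would permute \<open>I\<close>.\<close>
        have "\<exists>i\<in>{..<N}-I. p i \<noteq> i"
        proof (rule ccontr)
          assume "\<not> ?thesis"
          then have "p permutes I"
            using p by (intro permutes_superset[of p "{0..<N}" I]) (auto simp: atLeast0LessThan)
          with p show False by simp
        qed
        then have "(\<Prod>i\<in>{..<N}-I. if p i = i then x else 0) = 0"
          by (intro prod_zero) auto
        then show "?t I p = 0" by simp
      qed
    qed
    also have "\<dots> = (\<Sum>p | p permutes I. signof p * (\<Prod>i\<in>I. A $$ (i, p i)) * x ^ (N - card I))"
    proof (intro sum.cong refl)
      fix p assume "p \<in> {p. p permutes I}"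
      then have "(\<Prod>i\<in>{..<N}-I. if p i = i then x else 0) = (\<Prod>i\<in>{..<N}-I. x)"
        by (intro prod.cong) (auto simp: permutes_not_in)
      also have "\<dots> = x ^ (N - card I)" using card_Diff_subset[OF fin I'] by simp
      finally show "?t I p = signof p * (\<Prod>i\<in>I. A $$ (i, p i)) * x ^ (N - card I)"
        by (simp add: mult.assoc)
    qed
    also have "\<dots> = det (submatrix A I I) * x ^ (N - card I)"
      unfolding det_submatrix_Leibniz[OF A I'] by (simp add: sum_distrib_right)
    finally show ?thesis .
  qed
  have "det (A + x \<cdot>\<^sub>m 1\<^sub>m N) = (\<Sum>p\<in>?P. signof p * (\<Prod>i<N. A $$ (i, p i) + (if p i = i then x else 0)))"
  proof -
    have "(A + x \<cdot>\<^sub>m 1\<^sub>m N) $$ (i, p i) = A $$ (i, p i) + (if p i = i then x else 0)"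
      if "p permutes {0..<N}" "i < N" for i p
    proof -
      have "p i < N" using permutes_in_image[OF that(1), of i] that(2) by simp
      then show ?thesis using A that(2) by auto
    qed
    then show ?thesis
      by (subst det_def'[of _ N]) (use A in \<open>auto intro!: sum.cong prod.cong simp: atLeast0LessThan\<close>)
  qed
  also have "\<dots> = (\<Sum>p\<in>?P. \<Sum>I\<in>Pow {..<N}. ?t I p)"
    by (simp add: prod_add sum_distrib_left)
  also have "\<dots> = (\<Sum>I\<in>Pow {..<N}. det (submatrix A I I) * x ^ (N - card I))"
    by (subst sum.swap) (rule sum.cong[OF refl summand])
  finally show ?thesis .
qed

lemma coeff_det_add_scalar_mat:
  fixes A :: "'a :: comm_ring_1 mat"
  assumes A: "A \<in> carrier_mat (n + k) (n + k)"
  shows "coeff (det (map_mat (\<lambda>a. [:a:]) A + [:0, 1:] \<cdot>\<^sub>m 1\<^sub>m (n + k))) k = sum_principal_minors n A"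
proof -
  interpret lift: comm_ring_hom "\<lambda>a :: 'a. [:a:]" by unfold_locales auto
  let ?N = "n + k"
  have sub: "det (submatrix (map_mat (\<lambda>a. [:a:]) A) I I) = [:det (submatrix A I I):]"
    if I: "I \<subseteq> {..<?N}" for I
  proof -
    have "finite I" using I finite_subset by blast
    have pick: "pick I i < ?N" if "i < card I" for i
      using pick_in_set_le[OF that] I by auto
    have "{i. i < ?N \<and> i \<in> I} = I" using I by auto
    then have "submatrix (map_mat (\<lambda>a. [:a:]) A) I I = map_mat (\<lambda>a. [:a:]) (submatrix A I I)"
      using A by (intro eq_matI) (auto simp: submatrix_def pick)
    then show ?thesis by (simp add: lift.hom_det)
  qed
  have "det (map_mat (\<lambda>a. [:a:]) A + [:0, 1:] \<cdot>\<^sub>m 1\<^sub>m ?N) =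
    (\<Sum>I\<in>Pow {..<?N}. det (submatrix (map_mat (\<lambda>a. [:a:]) A) I I) * [:0, 1:] ^ (?N - card I))"
    using A by (intro det_add_scalar_mat) auto
  also have "\<dots> = (\<Sum>I\<in>Pow {..<?N}. monom (det (submatrix A I I)) (?N - card I))"
    by (intro sum.cong refl) (simp add: sub monom_altdef)
  also have "coeff \<dots> k = (\<Sum>I\<in>Pow {..<?N}. if ?N - card I = k then det (submatrix A I I) else 0)"
    by (simp add: coeff_sum)
  also have "\<dots> = (\<Sum>I\<in>{I \<in> Pow {..<?N}. ?N - card I = k}. det (submatrix A I I))"
    by (rule sum.inter_filter[symmetric]) simp
  also have "{I \<in> Pow {..<?N}. ?N - card I = k} = {I. I \<subseteq> {..<?N} \<and> card I = n}"
  proof -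
    have "?N - card I = k \<longleftrightarrow> card I = n" if "I \<subseteq> {..<?N}" for I
    proof -
      \<comment> \<open>Subtraction of naturals is truncated, so for \<open>k = 0\<close> the
        equivalence depends on this bound.\<close>
      have "card I \<le> ?N" using card_mono[OF _ that] by simp
      then show ?thesis by linarith
    qed
    then show ?thesis unfolding Pow_iff by (intro Collect_cong conj_cong refl)
  qed
  finally show ?thesis using A by (simp add: sum_principal_minors_def)
qed

section \<open>Toeplitz-Hessenberg determinants\<close>

text \<open>The first row is left free because deleting row \<open>1\<close> and column \<open>0\<close> only shifts it, which makes
  the class closed under expansion along the first column.\<close>

definition toeplitz_hessenberg :: "nat \<Rightarrow> (nat \<Rightarrow> 'a :: comm_ring_1) \<Rightarrow> (nat \<Rightarrow> 'a) \<Rightarrow> 'a mat" where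
  "toeplitz_hessenberg N f h = mat N N (\<lambda>(i, j).
     if i = 0 then f j else if i \<le> j then h (j - i) else if i = j + 1 then -1 else 0)"

text \<open>Deleting row 0 leaves a matrix whose first row is \<open>h\<close>; deleting row 1
  shifts \<open>f\<close> by one place. Hence the induction has to range over all
  \<open>f\<close>.\<close>

lemma det_toeplitz_hessenberg:
  "det (toeplitz_hessenberg (Suc N) f h) =
    (\<Sum>j\<le>N. f j * det (toeplitz_hessenberg (N - j) h h))"
proof (induction N arbitrary: f)
  case 0
  have "toeplitz_hessenberg 0 h h = 1\<^sub>m 0" for h :: "nat \<Rightarrow> 'a"
    by (auto simp: toeplitz_hessenberg_def)
  then show ?case
    by (simp add: toeplitz_hessenberg_def det_single)
next
  case (Suc N)
  let ?T = "toeplitz_hessenberg (Suc (Suc N)) f h"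
  have T: "?T \<in> carrier_mat (Suc (Suc N)) (Suc (Suc N))"
    by (simp add: toeplitz_hessenberg_def)
  have del0: "mat_delete ?T 0 0 = toeplitz_hessenberg (Suc N) h h"
    by (rule eq_matI) (auto simp: mat_delete_def toeplitz_hessenberg_def)
  have del1: "mat_delete ?T 1 0 = toeplitz_hessenberg (Suc N) (\<lambda>j. f (Suc j)) h"
    by (rule eq_matI) (auto simp: mat_delete_def toeplitz_hessenberg_def)
  have "det ?T = (\<Sum>i<Suc (Suc N). ?T $$ (i, 0) * cofactor ?T i 0)"
    by (rule laplace_expansion_column[OF T]) simp
  also have "\<dots> = (\<Sum>i\<in>{0,1}. ?T $$ (i, 0) * cofactor ?T i 0)"
    by (rule sum.mono_neutral_right) (auto simp: toeplitz_hessenberg_def)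
  \<comment> \<open>The entry -1 at position (1, 0) cancels the sign of its cofactor.\<close>
  also have "\<dots> = f 0 * det (toeplitz_hessenberg (Suc N) h h)
      + det (toeplitz_hessenberg (Suc N) (\<lambda>j. f (Suc j)) h)"
    using del0 del1 by (simp add: cofactor_def) (simp add: toeplitz_hessenberg_def)
  also have "\<dots> = (\<Sum>j\<le>Suc N. f j * det (toeplitz_hessenberg (Suc N - j) h h))"
    by (subst Suc.IH) (simp add: sum.atMost_Suc_shift del: sum.atMost_Suc)
  finally show ?case .
qed

section \<open>Recursion for weak compositions\<close>

lemma weak_compositions_0_0:
  assumes "\<forall>p\<in>M. 1 \<le> fst p"
  shows "weak_compositions 0 0 (with_zero M) = {[]}"
proof -
  have "ps = []" if "ps \<in> weak_compositions 0 0 (with_zero M)" for ps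
    using that by (cases ps) (auto simp: weak_compositions_def split: if_splits)
  then show ?thesis by (auto simp: weak_compositions_def)
qed

text \<open>Split by the first part, which exists because \<open>n + k > 0\<close>. A part from
  \<open>M\<close> has positive size and leaves the number of zeros unchanged; the part
  \<open>(0, 1)\<close> uses up one zero.\<close>

lemma weak_compositions_Cons:
  assumes M: "\<forall>p\<in>M. 1 \<le> fst p" and nk: "n + k > 0"
  shows "weak_compositions n k (with_zero M) =
    (\<Union>p\<in>{p \<in> M. fst p \<le> n}. Cons p ` weak_compositions (n - fst p) k (with_zero M)) \<union>
    (if k = 0 then {} else Cons (0, 1) ` weak_compositions n (k - 1) (with_zero M))"
    (is "?W = ?R")
proof
  show "?R \<subseteq> ?W"
    using M by (fastforce simp: weak_compositions_def with_zero_def split: if_splits)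
  show "?W \<subseteq> ?R"
  proof
    fix ps assume ps: "ps \<in> ?W"
    then have "ps \<noteq> []" using nk by (auto simp: weak_compositions_def)
    then obtain p ps' where [simp]: "ps = p # ps'" by (cases ps) auto
    show "ps \<in> ?R"
    proof (cases "p \<in> M")
      case True
      then have "fst p \<noteq> 0" using M by auto
      then have "ps' \<in> weak_compositions (n - fst p) k (with_zero M)" "fst p \<le> n"
        using ps by (auto simp: weak_compositions_def)
      then show ?thesis using True by (intro UnI1 UN_I[of p]) auto
    next
      case False
      then have "p = (0, 1)" using ps by (auto simp: weak_compositions_def with_zero_def)
      then have "ps' \<in> weak_compositions n (k - 1) (with_zero M)" "k \<noteq> 0"
        using ps by (auto simp: weak_compositions_def)
      then show ?thesis using \<open>p = (0, 1)\<close> by auto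
    qed
  qed
qed

lemma cw_rec:
  assumes fin: "finite M" and M: "\<forall>p\<in>M. 1 \<le> fst p" and nk: "n + k > 0"
  shows "cw n k (with_zero M) =
    (\<Sum>j<n. card {p \<in> M. fst p = Suc j} * cw (n - Suc j) k (with_zero M)) +
    (if k = 0 then 0 else cw n (k - 1) (with_zero M))"
proof -
  let ?W = "\<lambda>n k. weak_compositions n k (with_zero M)"
  let ?Mn = "{p \<in> M. fst p \<le> n}"
  have finW: "finite (?W a b)" for a b
    by (rule finite_weak_compositions) (simp add: with_zero_def fin)
  have cardC: "card (Cons p ` ?W a b) = cw a b (with_zero M)" for p a b
    by (simp add: card_image cw_def)
  have "card (\<Union>p\<in>?Mn. Cons p ` ?W (n - fst p) k) = (\<Sum>p\<in>?Mn. cw (n - fst p) k (with_zero M))"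
    by (subst card_UN_disjoint) (auto simp: fin finW cardC)
  \<comment> \<open>Parts are grouped by size, with \<open>j\<close> one less than the size to match
    the diagonal offset in the matrix.\<close>
  also have "\<dots> = (\<Sum>j<n. \<Sum>p\<in>{p \<in> ?Mn. fst p - 1 = j}. cw (n - fst p) k (with_zero M))"
    using M by (intro sum.group[symmetric]) (force simp: fin)+
  also have "\<dots> = (\<Sum>j<n. card {p \<in> M. fst p = Suc j} * cw (n - Suc j) k (with_zero M))"
  proof (intro sum.cong refl)
    fix j assume "j \<in> {..<n}"
    then have "{p \<in> ?Mn. fst p - 1 = j} = {p \<in> M. fst p = Suc j}" using M by force
    then show "(\<Sum>p\<in>{p \<in> ?Mn. fst p - 1 = j}. cw (n - fst p) k (with_zero M)) =
      card {p \<in> M. fst p = Suc j} * cw (n - Suc j) k (with_zero M)" by simp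
  qed
  finally have UN: "card (\<Union>p\<in>?Mn. Cons p ` ?W (n - fst p) k) =
    (\<Sum>j<n. card {p \<in> M. fst p = Suc j} * cw (n - Suc j) k (with_zero M))" .
  have "cw n k (with_zero M) = card (\<Union>p\<in>?Mn. Cons p ` ?W (n - fst p) k) +
    card (if k = 0 then {} else Cons (0, 1) ` ?W n (k - 1))"
    unfolding cw_def weak_compositions_Cons[OF M nk]
    using M by (intro card_Un_disjoint) (auto simp: fin finW)
  then show ?thesis by (simp add: UN cardC)
qed

section \<open>Matching the two recursions\<close>

text \<open>Here \<open>N\<close> is the sum of the parts plus the number of zeros: removing a part
  of size \<open>l\<close> lowers it by \<open>l\<close>, removing a zero lowers it by 1. The
  indeterminate in \<open>h 0\<close> marks the zeros.\<close>

lemma coeff_det_toeplitz_hessenberg_cw: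
  fixes M :: "(nat \<times> nat) set"
  assumes fin: "finite M" and M: "\<forall>p\<in>M. 1 \<le> fst p"
  defines "h \<equiv> \<lambda>j. [:int (card {p \<in> M. fst p = Suc j}):] + (if j = 0 then [:0, 1:] else 0)"
  shows "coeff (det (toeplitz_hessenberg N h h)) k =
    (if k \<le> N then int (cw (N - k) k (with_zero M)) else 0)"
proof (induction N arbitrary: k rule: less_induct)
  case (less N)
  let ?b = "\<lambda>j. int (card {p \<in> M. fst p = Suc j})"
  let ?F = "\<lambda>N. det (toeplitz_hessenberg N h h)"
  show ?case
  proof (cases N)
    case 0
    have "toeplitz_hessenberg 0 h h = 1\<^sub>m 0"
      by (auto simp: toeplitz_hessenberg_def)
    then show ?thesis using 0
      by (simp add: cw_def weak_compositions_0_0[OF M])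
  next
    case (Suc N')
    have "?F N = (\<Sum>j\<le>N'. [:?b j:] * ?F (N' - j)) + (\<Sum>j\<le>N'. if j = 0 then [:0, 1:] * ?F (N' - j) else 0)"
      unfolding Suc det_toeplitz_hessenberg sum.distrib[symmetric]
      by (intro sum.cong refl) (auto simp: h_def algebra_simps)
    also have "\<dots> = (\<Sum>j\<le>N'. [:?b j:] * ?F (N' - j)) + [:0, 1:] * ?F N'"
      by (subst sum.delta) auto
    finally have "coeff (?F N) k = (\<Sum>j\<le>N'. ?b j * coeff (?F (N' - j)) k) +
        (if k = 0 then 0 else coeff (?F N') (k - 1))"
      by (simp add: coeff_sum coeff_pCons split: nat.split)
    \<comment> \<open>By induction the coefficients with \<open>k > N' - j\<close> vanish, which
      cuts the sum down to \<open>j < N - k\<close>, the range in \<open>cw_rec\<close>.\<close>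
    also have "(\<Sum>j\<le>N'. ?b j * coeff (?F (N' - j)) k) =
        (\<Sum>j\<le>N'. if j < N - k then ?b j * int (cw (N - k - Suc j) k (with_zero M)) else 0)"
    proof (intro sum.cong refl)
      fix j assume "j \<in> {..N'}"
      then have "k \<le> N' - j \<longleftrightarrow> j < N - k" "N' - j - k = N - k - Suc j" if "k \<le> N"
        using Suc that by auto
      moreover have "\<not> k \<le> N' - j" if "\<not> k \<le> N" using that Suc by auto
      moreover have "N' - j < N" using Suc by simp
      ultimately show "?b j * coeff (?F (N' - j)) k =
          (if j < N - k then ?b j * int (cw (N - k - Suc j) k (with_zero M)) else 0)"
        by (cases "k \<le> N") (simp_all add: less.IH)
    qed
    also have "\<dots> = (\<Sum>j<N - k. ?b j * int (cw (N - k - Suc j) k (with_zero M)))"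
      unfolding sum.inter_filter[symmetric, OF finite_atMost]
      using Suc by (intro sum.cong) auto
    \<comment> \<open>Size and exponent both drop by one, so the sum of the parts remains
      \<open>N - k\<close>.\<close>
    also have "(if k = 0 then 0 else coeff (?F N') (k - 1)) =
        (if k = 0 \<or> \<not> k \<le> N then 0 else int (cw (N - k) (k - 1) (with_zero M)))"
      using Suc by (auto simp: less.IH)
    finally have eq: "coeff (?F N) k = (\<Sum>j<N - k. ?b j * int (cw (N - k - Suc j) k (with_zero M))) +
        (if k = 0 \<or> \<not> k \<le> N then 0 else int (cw (N - k) (k - 1) (with_zero M)))" .
    show ?thesis
    proof (cases "k \<le> N")
      case True
      then show ?thesis
        unfolding eq using Suc by (subst cw_rec[OF fin M]) auto
    next
      case False
      then show ?thesis unfolding eq by simp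
    qed
  qed
qed

section \<open>Entries of the matrix and conclusion\<close>

lemma finite_typed_parts: "finite (typed_parts r m q)"
proof -
  have "typed_parts r m q = (\<Union>s\<in>{1..r}. Pair (m s) ` {1..q s})"
    by (auto simp: typed_parts_def)
  then show ?thesis by simp
qed

text \<open>Injectivity of \<open>m\<close> makes the index \<open>s\<close> chosen by
  \<open>THE\<close> unique, so \<open>q s\<close> counts all typed parts of size
  \<open>m s\<close>. This exhibits the Toeplitz form: the diagonal \<open>j - i\<close> belongs to
  size \<open>Suc (j - i)\<close>.\<close>

lemma P_mat_index:
  assumes inj: "inj_on m {1..r}" and pos: "\<forall>s\<in>{1..r}. 1 \<le> m s" and ij: "i < N" "j < N"
  shows "P_mat N r m q $$ (i, j) =
    (if i \<le> j then int (card {p \<in> typed_parts r m q. fst p = Suc (j - i)})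
     else if i = j + 1 then -1 else 0)"
proof (cases "i \<le> j")
  case False
  then have "\<not> (\<exists>s\<in>{1..r}. int j - int i = int (m s) - 1)"
    using pos by fastforce
  then show ?thesis using False ij by (simp add: P_mat_def)
next
  case True
  then have iff: "int j - int i = int (m s) - 1 \<longleftrightarrow> m s = Suc (j - i)" for s by auto
  show ?thesis
  proof (cases "\<exists>s\<in>{1..r}. m s = Suc (j - i)")
    case ex: True
    then obtain s where s: "s \<in> {1..r}" "m s = Suc (j - i)" by blast
    have uniq: "t = s" if "t \<in> {1..r}" "m t = Suc (j - i)" for t
      using inj_onD[OF inj _ that(1) s(1)] that(2) s(2) by simp
    have "(THE s. s \<in> {1..r} \<and> m s = Suc (j - i)) = s"
      using s by (intro the_equality) (auto intro: uniq)
    moreover have "{p \<in> typed_parts r m q. fst p = Suc (j - i)} = Pair (m s) ` {1..q s}"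
    proof (intro equalityI subsetI)
      fix p assume "p \<in> {p \<in> typed_parts r m q. fst p = Suc (j - i)}"
      then obtain t u where "p = (m t, u)" "t \<in> {1..r}" "u \<in> {1..q t}" "m t = Suc (j - i)"
        by (auto simp: typed_parts_def)
      then show "p \<in> Pair (m s) ` {1..q s}" using uniq[of t] by blast
    next
      fix p assume "p \<in> Pair (m s) ` {1..q s}"
      then obtain u where u: "u \<in> {1..q s}" "p = (m s, u)" by blast
      then have "p \<in> typed_parts r m q" using s(1) unfolding typed_parts_def by blast
      then show "p \<in> {p \<in> typed_parts r m q. fst p = Suc (j - i)}" using s(2) u(2) by simp
    qed
    ultimately show ?thesis using True ij ex by (simp add: P_mat_def iff card_image inj_on_def)
  next
    case ex: False
    then have "{p \<in> typed_parts r m q. fst p = Suc (j - i)} = {}"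
      by (auto simp: typed_parts_def)
    then have "card {p \<in> typed_parts r m q. fst p = Suc (j - i)} = 0" by (simp only: card.empty)
    then show ?thesis using True ij ex by (simp add: P_mat_def iff)
  qed
qed

theorem theorem9:
  fixes n k r :: nat and m q :: "nat \<Rightarrow> nat"
  assumes "n \<ge> 1"
    and "\<forall>s\<in>{1..r}. 1 \<le> m s \<and> m s \<le> n"
    and "strict_mono_on {1..r} m"
    and "\<forall>s\<in>{1..r}. 1 \<le> q s"
  shows "int (cw n k (with_zero (typed_parts r m q))) =
         sum_principal_minors n (P_mat (n + k) r m q)"
proof -
  let ?M = "typed_parts r m q" and ?P = "P_mat (n + k) r m q"
  let ?h = "\<lambda>j. [:int (card {p \<in> ?M. fst p = Suc j}):] + (if j = 0 then [:0, 1:] else 0)"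
  have pos: "\<forall>s\<in>{1..r}. 1 \<le> m s" using assms(2) by blast
  have inj: "inj_on m {1..r}" using assms(3) by (rule strict_mono_on_imp_inj_on)
  have M: "\<forall>p\<in>?M. 1 \<le> fst p" using pos by (auto simp: typed_parts_def)
  have P: "?P \<in> carrier_mat (n + k) (n + k)" by (simp add: P_mat_def)
  \<comment> \<open>The indeterminate added on the diagonal is the \<open>j = 0\<close> summand of
    \<open>?h\<close>. Row 0 follows the same pattern as the others, so both arguments are
    \<open>?h\<close>.\<close>
  have "map_mat (\<lambda>a. [:a:]) ?P + [:0, 1:] \<cdot>\<^sub>m 1\<^sub>m (n + k) = toeplitz_hessenberg (n + k) ?h ?h"
    using P by (intro eq_matI) (auto simp: toeplitz_hessenberg_def P_mat_index[OF inj pos] one_pCons)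
  then have "sum_principal_minors n ?P = coeff (det (toeplitz_hessenberg (n + k) ?h ?h)) k"
    using coeff_det_add_scalar_mat[OF P] by simp
  also have "\<dots> = int (cw n k (with_zero ?M))"
    by (subst coeff_det_toeplitz_hessenberg_cw[OF finite_typed_parts M]) simp
  finally show ?thesis by simp
qed

end
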